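(* Let $(X,\tau,d)$ be a pre-e.m.t. space such that $(X,\tau)$ is compact. Then $(X,\tau,d)$ is an e.m.t. space if and only if $d:X\times X\to[0,+\infty]$ is lower semicontinuous with respect to the product topology $\tau\otimes\tau$.
   Context: An extended distance on a set $X$ is a function $d:X\times X\to[0,+\infty]$ that is symmetric, satisfies the triangle inequality, and is such that $d(x,y)=0$ if and only if $x=y$. A pre-e.m.t. space is a triple $(X,\tau,d)$ with $\tau$ a topology on $X$ and $d$ an extended distance on $X$ (no compatibility between them is required). $\mathrm{LIP}_{b,1}(X,\tau,d)$ is the set of all bounded $\tau$-continuous functions $f:X\to\mathbb{R}$ with $|f(x)-f(y)|\le d(x,y)$ for all $x,y\in X$. An e.m.t. space is a pre-e.m.t. space $(X,\tau,d)$ such that (i) $\tau$ is the initial topology of $\mathrm{LIP}_{b,1}(X,\tau,d)$ and (ii) $d(x,y)=\sup\{|f(x)-f(y)|:f\in\mathrm{LIP}_{b,1}(X,\tau,d)\}$ for all $x,y\in X$. Compactness of $(X,\tau)$ means every open cover has a finite subcover (Hausdorffness is not assumed). *)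

theory Defs
  imports "HOL-Analysis.Analysis"
begin

text \<open>The underlying set \<open>X\<close> of a space \<open>(X, \<tau>, d)\<close> is \<open>topspace \<tau>\<close>; the values of \<open>d\<close>, and of
  real functions, outside \<open>X\<close> are irrelevant. The interval \<open>[0, +\<infinity>]\<close> is the type \<^typ>\<open>ennreal\<close>.\<close>

definition extended_distance_on :: "'a set \<Rightarrow> ('a \<Rightarrow> 'a \<Rightarrow> ennreal) \<Rightarrow> bool" where
  "extended_distance_on X d \<longleftrightarrow>
     (\<forall>x\<in>X. \<forall>y\<in>X. d x y = d y x) \<and>
     (\<forall>x\<in>X. \<forall>y\<in>X. \<forall>z\<in>X. d x z \<le> d x y + d y z) \<and>
     (\<forall>x\<in>X. \<forall>y\<in>X. d x y = 0 \<longleftrightarrow> x = y)"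

definition pre_emt_space :: "'a topology \<Rightarrow> ('a \<Rightarrow> 'a \<Rightarrow> ennreal) \<Rightarrow> bool" where
  "pre_emt_space \<tau> d \<longleftrightarrow> extended_distance_on (topspace \<tau>) d"

definition LIP_b1 :: "'a topology \<Rightarrow> ('a \<Rightarrow> 'a \<Rightarrow> ennreal) \<Rightarrow> ('a \<Rightarrow> real) set" where
  "LIP_b1 \<tau> d =
     {f. bounded (f ` topspace \<tau>) \<and> continuous_map \<tau> euclideanreal f \<and>
         (\<forall>x\<in>topspace \<tau>. \<forall>y\<in>topspace \<tau>. ennreal \<bar>f x - f y\<bar> \<le> d x y)}"

text \<open>The coarsest topology on \<open>X\<close> for which all functions in \<open>F\<close> are continuous into \<open>Y\<close>. The
  set \<open>X\<close> itself is listed as a generator so that the carrier is \<open>X\<close> even when \<open>F\<close> is empty.\<close>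

definition initial_topology :: "'a set \<Rightarrow> 'b topology \<Rightarrow> ('a \<Rightarrow> 'b) set \<Rightarrow> 'a topology" where
  "initial_topology X Y F =
     topology_generated_by (insert X {{x \<in> X. f x \<in> U} | f U. f \<in> F \<and> openin Y U})"

definition emt_space :: "'a topology \<Rightarrow> ('a \<Rightarrow> 'a \<Rightarrow> ennreal) \<Rightarrow> bool" where
  "emt_space \<tau> d \<longleftrightarrow>
     pre_emt_space \<tau> d \<and>
     \<tau> = initial_topology (topspace \<tau>) euclideanreal (LIP_b1 \<tau> d) \<and>
     (\<forall>x\<in>topspace \<tau>. \<forall>y\<in>topspace \<tau>. d x y = (SUP f\<in>LIP_b1 \<tau> d. ennreal \<bar>f x - f y\<bar>))"

definition lower_semicontinuous_map :: "'a topology \<Rightarrow> ('a \<Rightarrow> 'b::linorder) \<Rightarrow> bool" where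
  "lower_semicontinuous_map \<tau> f \<longleftrightarrow> (\<forall>a. openin \<tau> {x \<in> topspace \<tau>. a < f x})"

end

theory Submission
  imports Defs
begin

text \<open>If \<open>d\<close> is the supremum of the functions \<open>\<bar>f x - f y\<bar>\<close> with \<open>f\<close> continuous, it is lower
  semicontinuous. Conversely, lower semicontinuity makes the diagonal \<open>{d \<le> 0}\<close> closed, so the
  space is compact Hausdorff, hence normal, and the closed thickenings of closed sets are closed.
  For \<open>c < d x\<^sub>0 y\<^sub>0\<close> this allows Urysohn's construction to be carried out with a quantitative
  nesting condition: one chooses open sets \<open>U\<^sub>q\<close>, for rational \<open>q\<close> in \<open>(0, c)\<close>, such that the
  \<open>(r - q)\<close>-thickening of the closure of \<open>U\<^sub>q\<close> lies in \<open>U\<^sub>r\<close> whenever \<open>q < r\<close>, with \<open>x\<^sub>0\<close> inside and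
  \<open>y\<^sub>0\<close> outside at the appropriate distances. Then \<open>x \<mapsto> inf {q. x \<in> U\<^sub>q}\<close> is continuous,
  \<open>1\<close>-Lipschitz, and takes the values \<open>0\<close> at \<open>x\<^sub>0\<close> and \<open>c\<close> at \<open>y\<^sub>0\<close>. Finally, the initial topology is
  Hausdorff and coarser than the compact topology \<open>\<tau>\<close>, so the two coincide.\<close>

section \<open>Lower semicontinuity of a supremum of continuous functions\<close>

lemma emt_space_imp_lower_semicontinuous:
  assumes "emt_space \<tau> d"
  shows "lower_semicontinuous_map (prod_topology \<tau> \<tau>) (\<lambda>(x, y). d x y)"
  unfolding lower_semicontinuous_map_def
proof
  fix a :: ennreal
  let ?S = "{z \<in> topspace (prod_topology \<tau> \<tau>). a < (case z of (x, y) \<Rightarrow> d x y)}"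
  let ?T = "\<lambda>f. {z \<in> topspace (prod_topology \<tau> \<tau>). ennreal \<bar>f (fst z) - f (snd z)\<bar> \<in> {a<..}}"
  have d: "d x y = (SUP f\<in>LIP_b1 \<tau> d. ennreal \<bar>f x - f y\<bar>)"
    if "x \<in> topspace \<tau>" "y \<in> topspace \<tau>" for x y
    using assms that unfolding emt_space_def by blast
  \<comment> \<open>A supremum exceeds \<open>a\<close> exactly when some member does, so it is
    enough to show each \<open>?T f\<close> open.\<close>
  have "?S = (\<Union>f\<in>LIP_b1 \<tau> d. ?T f)"
    by (auto simp: d less_SUP_iff)
  moreover have "openin (prod_topology \<tau> \<tau>) (?T f)" if "f \<in> LIP_b1 \<tau> d" for f
  proof -
    have f: "continuous_map \<tau> euclideanreal f"
      using that by (simp add: LIP_b1_def)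
    have "continuous_map (prod_topology \<tau> \<tau>) euclideanreal (\<lambda>z. \<bar>f (fst z) - f (snd z)\<bar>)"
      using continuous_map_compose[OF continuous_map_fst f]
            continuous_map_compose[OF continuous_map_snd f]
      by (intro continuous_map_real_abs continuous_map_diff) (simp_all add: o_def)
    moreover have "continuous_map euclideanreal euclidean ennreal"
      using continuous_on_ennreal[OF continuous_on_id] by simp
    ultimately have "continuous_map (prod_topology \<tau> \<tau>) euclidean
        (ennreal \<circ> (\<lambda>z. \<bar>f (fst z) - f (snd z)\<bar>))"
      by (rule continuous_map_compose)
    then show ?thesis
      using openin_continuous_map_preimage[of "prod_topology \<tau> \<tau>" euclidean _ "{a<..}"]
      by (simp add: o_def)
  qed
  ultimately show "openin (prod_topology \<tau> \<tau>) ?S"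
    by auto
qed

section \<open>Extended distances and closed sublevel sets\<close>

lemma extended_distance_on_commute:
  "extended_distance_on X d \<Longrightarrow> x \<in> X \<Longrightarrow> y \<in> X \<Longrightarrow> d x y = d y x"
  by (drule extended_distance_on_def[THEN iffD1, THEN conjunct1]) blast

lemma extended_distance_on_triangle:
  "extended_distance_on X d \<Longrightarrow> x \<in> X \<Longrightarrow> y \<in> X \<Longrightarrow> z \<in> X \<Longrightarrow> d x z \<le> d x y + d y z"
  by (drule extended_distance_on_def[THEN iffD1, THEN conjunct2, THEN conjunct1]) blast

lemma extended_distance_on_eq_0_iff:
  "extended_distance_on X d \<Longrightarrow> x \<in> X \<Longrightarrow> y \<in> X \<Longrightarrow> d x y = 0 \<longleftrightarrow> x = y"
  by (drule extended_distance_on_def[THEN iffD1, THEN conjunct2, THEN conjunct2]) blast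

lemma lower_semicontinuous_imp_closedin_le:
  assumes "lower_semicontinuous_map X f"
  shows "closedin X {x \<in> topspace X. f x \<le> a}"
proof -
  have "topspace X - {x \<in> topspace X. a < f x} = {x \<in> topspace X. f x \<le> a}"
    by auto
  then show ?thesis
    using assms closedin_diff[OF closedin_topspace, of X "{x \<in> topspace X. a < f x}"]
    unfolding lower_semicontinuous_map_def by simp
qed

lemma lower_semicontinuous_imp_Hausdorff_space:
  assumes "pre_emt_space \<tau> d"
    and "lower_semicontinuous_map (prod_topology \<tau> \<tau>) (\<lambda>(x, y). d x y)"
  shows "Hausdorff_space \<tau>"
proof -
  have "{z \<in> topspace (prod_topology \<tau> \<tau>). (case z of (x, y) \<Rightarrow> d x y) \<le> 0}
      = (\<lambda>x. (x, x)) ` topspace \<tau>"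
    using assms(1) by (auto simp: pre_emt_space_def extended_distance_on_eq_0_iff)
  then show ?thesis
    using lower_semicontinuous_imp_closedin_le[OF assms(2), of 0]
    by (simp add: Hausdorff_space_closedin_diagonal)
qed

section \<open>Closed thickenings\<close>

text \<open>An actual point of \<open>K\<close> within distance \<open>s\<close> is demanded, rather
  than a bound on the infimum of the distances, so that the set is a projection. For negative
  \<open>s\<close> the bound \<open>ennreal s\<close> is 0.\<close>

definition thickening :: "'a topology \<Rightarrow> ('a \<Rightarrow> 'a \<Rightarrow> ennreal) \<Rightarrow> real \<Rightarrow> 'a set \<Rightarrow> 'a set" where
  "thickening \<tau> d s K = {y \<in> topspace \<tau>. \<exists>x\<in>K. d x y \<le> ennreal s}"

text \<open>The thickening is the projection of a closed subset of the product, and projecting along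
  a compact factor is a closed map.\<close>

lemma closedin_thickening:
  assumes "compact_space \<tau>"
    and "lower_semicontinuous_map (prod_topology \<tau> \<tau>) (\<lambda>(x, y). d x y)"
    and "closedin \<tau> K"
  shows "closedin \<tau> (thickening \<tau> d s K)"
proof -
  let ?C = "(K \<times> topspace \<tau>) \<inter>
      {z \<in> topspace (prod_topology \<tau> \<tau>). (case z of (x, y) \<Rightarrow> d x y) \<le> ennreal s}"
  have "closedin (prod_topology \<tau> \<tau>) (K \<times> topspace \<tau>)"
    using assms(3) by (simp add: closedin_prod_Times_iff)
  then have "closedin (prod_topology \<tau> \<tau>) ?C"
    using lower_semicontinuous_imp_closedin_le[OF assms(2)] by (rule closedin_Int)
  then have "closedin \<tau> (snd ` ?C)"
    using Abstract_Topological_Spaces.closed_map_snd[OF assms(1), of \<tau>]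
    by (simp add: closed_map_def)
  moreover have "snd ` ?C = thickening \<tau> d s K"
    using closedin_subset[OF assms(3)] by (force simp: thickening_def image_iff)
  ultimately show ?thesis
    by simp
qed

text \<open>By the triangle inequality through a common point. This splits a gap of width
  \<open>s + t\<close> between two sets so that a new set can be placed in between.\<close>

lemma thickening_disjoint:
  assumes d: "extended_distance_on (topspace \<tau>) d"
    and "K \<subseteq> topspace \<tau>" "L \<subseteq> topspace \<tau>" "0 \<le> s" "0 \<le> t"
    and "disjnt (thickening \<tau> d (s + t) K) L"
  shows "disjnt (thickening \<tau> d s K) (thickening \<tau> d t L)"
proof -
  have False if "x \<in> K" "y \<in> topspace \<tau>" "z \<in> L" "d x y \<le> ennreal s" "d z y \<le> ennreal t" for x y z
  proof -
    have X: "x \<in> topspace \<tau>" "z \<in> topspace \<tau>"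
      using that assms by auto
    have "d x z \<le> d x y + d y z"
      using d X that by (simp add: extended_distance_on_triangle)
    also have "\<dots> \<le> ennreal s + ennreal t"
      using X that extended_distance_on_commute[OF d, of y z] by (intro add_mono) simp_all
    also have "\<dots> = ennreal (s + t)"
      using assms by simp
    finally show False
      using assms(6) X that by (auto simp: thickening_def disjnt_iff)
  qed
  then show ?thesis
    unfolding thickening_def disjnt_iff by blast
qed

lemma subset_thickening:
  assumes "extended_distance_on (topspace \<tau>) d" "K \<subseteq> topspace \<tau>"
  shows "K \<subseteq> thickening \<tau> d s K"
proof
  fix x assume "x \<in> K"
  then have "d x x = 0"
    using extended_distance_on_eq_0_iff[OF assms(1)] assms(2) by blast
  then show "x \<in> thickening \<tau> d s K"
    using \<open>x \<in> K\<close> assms(2) by (auto simp: thickening_def intro!: bexI[of _ x])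
qed

lemma disjnt_thickening_commute:
  assumes d: "extended_distance_on (topspace \<tau>) d"
    and "K \<subseteq> topspace \<tau>" "L \<subseteq> topspace \<tau>"
  shows "disjnt (thickening \<tau> d s K) L \<longleftrightarrow> disjnt K (thickening \<tau> d s L)"
proof -
  have "d x y = d y x" if "x \<in> K" "y \<in> L" for x y
    using extended_distance_on_commute[OF d] assms(2,3) that by blast
  then show ?thesis
    using assms(2,3) unfolding thickening_def disjnt_iff by (auto; metis subsetD)
qed

text \<open>Symmetry of \<open>d\<close> moves the thickening onto the complement of
  \<open>U\<close>. A constraint on a still unknown \<open>K\<close> thus becomes the avoidance of a
  fixed set, which is what normality can deliver.\<close>

lemma thickening_subset_iff_disjnt:
  assumes d: "extended_distance_on (topspace \<tau>) d"
    and "K \<subseteq> topspace \<tau>"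
  shows "thickening \<tau> d s K \<subseteq> U \<longleftrightarrow> disjnt K (thickening \<tau> d s (topspace \<tau> - U))"
proof -
  have "thickening \<tau> d s K \<subseteq> U \<longleftrightarrow> disjnt (thickening \<tau> d s K) (topspace \<tau> - U)"
    by (auto simp: thickening_def disjnt_iff)
  then show ?thesis
    using disjnt_thickening_commute[OF d assms(2), of "topspace \<tau> - U"] by simp
qed

section \<open>The quantitative Urysohn construction\<close>

text \<open>The sets are chosen one after another along the enumeration \<open>e\<close> of levels.
  At each stage only finitely many earlier sets impose constraints, and normality satisfies all of
  them at once.\<close>

lemma Urysohn_family_exists:
  fixes e :: "nat \<Rightarrow> real"
  assumes pre: "pre_emt_space \<tau> d" and comp: "compact_space \<tau>"
    and lsc: "lower_semicontinuous_map (prod_topology \<tau> \<tau>) (\<lambda>(x, y). d x y)"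
    and K: "closedin \<tau> K" and L: "closedin \<tau> L"
    and KL: "disjnt (thickening \<tau> d c K) L"
    and e: "\<And>n. 0 < e n \<and> e n < c"
  obtains U where
    "\<And>n. openin \<tau> (U n)" "\<And>n. K \<subseteq> U n" "\<And>n. disjnt L (U n)"
    "\<And>m n. e m < e n \<Longrightarrow> thickening \<tau> d (e n - e m) (\<tau> closure_of U m) \<subseteq> U n"
proof -
  let ?X = "topspace \<tau>" and ?N = "thickening \<tau> d"
  have d: "extended_distance_on ?X d"
    using pre by (simp add: pre_emt_space_def)
  have normal: "normal_space \<tau>"
    using compact_Hausdorff_or_regular_imp_normal_space[OF comp]
      lower_semicontinuous_imp_Hausdorff_space[OF pre lsc] by blast
  have KX: "K \<subseteq> ?X" and LX: "L \<subseteq> ?X"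
    using K L closedin_subset by auto
  have clX: "\<tau> closure_of V \<subseteq> ?X" for V
    by (rule closure_of_subset_topspace)
  \<comment> \<open>\<open>V\<close> is an admissible choice at level \<open>e n\<close>, given the
    earlier sets \<open>f m\<close>. The conditions on \<open>K\<close> and \<open>L\<close> are
    nesting conditions too: \<open>K\<close> acts as the set at level 0 and the complement of
    \<open>L\<close> as the set at level \<open>c\<close>. Merely containing \<open>K\<close> and
    avoiding \<open>L\<close> would not keep the recursion going.\<close>
  define P where "P f n V \<longleftrightarrow> openin \<tau> V \<and> ?N (e n) K \<subseteq> V \<and>
      disjnt (?N (c - e n) L) (\<tau> closure_of V) \<and>
      (\<forall>m<n. (e m < e n \<longrightarrow> ?N (e n - e m) (\<tau> closure_of f m) \<subseteq> V) \<and>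
             (e n < e m \<longrightarrow> ?N (e m - e n) (\<tau> closure_of V) \<subseteq> f m))"
    for f :: "nat \<Rightarrow> 'a set" and n V
  have "\<exists>f. \<forall>n. P f n (f n)"
  proof (rule dependent_wf_choice[OF wf_less_than])
    show "P f n V = P g n V" if "\<And>m. (m, n) \<in> less_than \<Longrightarrow> f m = g m" for f g n V
      using that unfolding P_def by simp
  next
    fix n f
    assume "\<And>m. (m, n) \<in> less_than \<Longrightarrow> P f m (f m)"
    then have IH: "P f m (f m)" if "m < n" for m
      using that by simp
    have op: "openin \<tau> (f m)" and inK: "?N (e m) K \<subseteq> f m"
      and outL: "disjnt (?N (c - e m) L) (\<tau> closure_of f m)" if "m < n" for m
      using IH[OF that] unfolding P_def by auto
    have nest: "?N (e l - e m) (\<tau> closure_of f m) \<subseteq> f l"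
      if "m < n" "l < n" "e m < e l" for m l
      using IH[of m] IH[of l] that unfolding P_def by (cases m l rule: linorder_cases) auto
    \<comment> \<open>\<open>A\<close> collects the closed sets that \<open>V\<close> must contain
      and \<open>B\<close> those that its closure must avoid. Both are finite, so their unions are
      closed.\<close>
    define A where "A = insert (?N (e n) K)
      ((\<lambda>m. ?N (e n - e m) (\<tau> closure_of f m)) ` {m. m < n \<and> e m < e n})"
    define B where "B = insert (?N (c - e n) L)
      ((\<lambda>m. ?N (e m - e n) (?X - f m)) ` {m. m < n \<and> e n < e m})"
    have closed: "closedin \<tau> (\<Union>A)" "closedin \<tau> (\<Union>B)"
      unfolding A_def B_def
      by (intro closedin_Union; auto intro!: closedin_thickening[OF comp lsc] K L closedin_diff
          simp: op)+
    \<comment> \<open>In each of the four cases \<open>e n\<close> cancels in the sum of the two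
      radii, leaving \<open>c\<close>, \<open>e l\<close>, \<open>c - e m\<close> or
      \<open>e l - e m\<close>. So \<open>thickening_disjoint\<close> reduces the claim to
      \<open>KL\<close>, \<open>inK\<close>, \<open>outL\<close> or \<open>nest\<close>.\<close>
    have "disjnt S T" if "S \<in> A" "T \<in> B" for S T
    proof -
      have S: "S = ?N (e n) K \<or>
          (\<exists>m<n. e m < e n \<and> S = ?N (e n - e m) (\<tau> closure_of f m))"
        using \<open>S \<in> A\<close> unfolding A_def by auto
      have T: "T = ?N (c - e n) L \<or> (\<exists>m<n. e n < e m \<and> T = ?N (e m - e n) (?X - f m))"
        using \<open>T \<in> B\<close> unfolding B_def by auto
      have en: "0 \<le> e n" "0 \<le> c - e n"
        using e[of n] by auto
      show ?thesis
        using S T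
      proof (elim disjE exE conjE)
        assume ST: "S = ?N (e n) K" "T = ?N (c - e n) L"
        show ?thesis
          unfolding ST using KL en by (intro thickening_disjoint d KX LX) simp_all
      next
        fix l assume l: "l < n" "e n < e l" and ST: "S = ?N (e n) K" "T = ?N (e l - e n) (?X - f l)"
        show ?thesis
          unfolding ST using inK[OF l(1)] l en
          by (intro thickening_disjoint d KX) (auto simp: disjnt_iff)
      next
        fix m assume m: "m < n" "e m < e n"
          and ST: "S = ?N (e n - e m) (\<tau> closure_of f m)" "T = ?N (c - e n) L"
        have "disjnt (?N (c - e m) (\<tau> closure_of f m)) L"
          using outL[OF m(1)] disjnt_thickening_commute[OF d clX LX] by (simp add: disjnt_sym)
        then show ?thesis
          unfolding ST using m en by (intro thickening_disjoint d clX LX) simp_all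
      next
        fix m l assume m: "m < n" "e m < e n" and l: "l < n" "e n < e l"
          and ST: "S = ?N (e n - e m) (\<tau> closure_of f m)" "T = ?N (e l - e n) (?X - f l)"
        show ?thesis
          unfolding ST using nest[OF m(1) l(1)] m l
          by (intro thickening_disjoint d clX) (auto simp: disjnt_iff)
      qed
    qed
    then have "disjnt (\<Union>A) (\<Union>B)"
      by (auto simp: disjnt_iff)
    then have "\<exists>V. openin \<tau> V \<and> \<Union>A \<subseteq> V \<and> disjnt (\<Union>B) (\<tau> closure_of V)"
      using normal closed by (intro normal_space[THEN iffD1, rule_format]) simp_all
    then obtain V where V: "openin \<tau> V" "\<Union>A \<subseteq> V" "disjnt (\<Union>B) (\<tau> closure_of V)"
      by (elim exE conjE)
    have "P f n V"
      unfolding P_def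
    proof (intro conjI allI impI)
      show "?N (e n) K \<subseteq> V" "disjnt (?N (c - e n) L) (\<tau> closure_of V)"
        using V unfolding A_def B_def by (auto simp: disjnt_iff)
    next
      fix m assume m: "m < n" "e m < e n"
      then show "?N (e n - e m) (\<tau> closure_of f m) \<subseteq> V"
        using V(2) unfolding A_def by auto
    next
      fix m assume m: "m < n" "e n < e m"
      then have "disjnt (\<tau> closure_of V) (?N (e m - e n) (?X - f m))"
        using V(3) unfolding B_def by (auto simp: disjnt_iff)
      then show "?N (e m - e n) (\<tau> closure_of V) \<subseteq> f m"
        using thickening_subset_iff_disjnt[OF d clX] by blast
    qed (fact V(1))
    then show "\<exists>V. P f n V" ..
  qed
  then obtain U where U: "\<And>n. P U n (U n)"
    by blast
  show thesis
  proof
    fix m n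
    show "openin \<tau> (U n)"
      using U[of n] by (simp add: P_def)
    show "K \<subseteq> U n"
      using U[of n] subset_thickening[OF d KX] unfolding P_def by blast
    have "L \<subseteq> ?N (c - e n) L" "U n \<subseteq> \<tau> closure_of U n"
      using U[of n] subset_thickening[OF d LX]
      by (simp_all add: P_def closure_of_subset openin_subset)
    then show "disjnt L (U n)"
      using U[of n] unfolding P_def by (meson disjnt_subset1 disjnt_subset2)
    show "?N (e n - e m) (\<tau> closure_of U m) \<subseteq> U n" if "e m < e n"
      using U[of m] U[of n] that unfolding P_def by (cases m n rule: linorder_cases) auto
  qed
qed

text \<open>The sets \<open>U n\<close> serve as approximate sublevel sets of \<open>f\<close> at
  the levels \<open>e n\<close>. Their plain nesting gives continuity, their nesting after
  thickening the Lipschitz bound.\<close>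

lemma LIP_b1_separating_closed_sets:
  fixes c :: real
  assumes pre: "pre_emt_space \<tau> d" and comp: "compact_space \<tau>"
    and lsc: "lower_semicontinuous_map (prod_topology \<tau> \<tau>) (\<lambda>(x, y). d x y)"
    and K: "closedin \<tau> K" and L: "closedin \<tau> L" and "0 < c"
    and KL: "disjnt (thickening \<tau> d c K) L"
  obtains f where "f \<in> LIP_b1 \<tau> d" "\<And>x. x \<in> K \<Longrightarrow> f x = 0" "\<And>x. x \<in> L \<Longrightarrow> f x = c"
proof -
  let ?X = "topspace \<tau>" and ?Q = "\<rat> \<inter> {0<..<c}"
  have d: "extended_distance_on ?X d"
    using pre by (simp add: pre_emt_space_def)
  define e where "e = from_nat_into ?Q"
  have dense: "\<exists>n. a < e n \<and> e n < b" if "a < b" "0 \<le> a" "b \<le> c" for a b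
  proof -
    obtain q where "q \<in> \<rat>" "a < q" "q < b"
      using Rats_dense_in_real[OF \<open>a < b\<close>] by blast
    moreover have "countable ?Q"
      using countable_rat by blast
    ultimately show ?thesis
      using from_nat_into_surj[of ?Q q] that unfolding e_def by auto
  qed
  have e: "0 < e n \<and> e n < c" for n
  proof -
    have "?Q \<noteq> {}"
      using Rats_dense_in_real[OF \<open>0 < c\<close>] by auto
    then show ?thesis
      using from_nat_into[of ?Q n] unfolding e_def by auto
  qed
  obtain U where op: "\<And>n. openin \<tau> (U n)" and KU: "\<And>n. K \<subseteq> U n" and LU: "\<And>n. disjnt L (U n)"
    and nest: "\<And>m n. e m < e n \<Longrightarrow> thickening \<tau> d (e n - e m) (\<tau> closure_of U m) \<subseteq> U n"
    by (rule Urysohn_family_exists[OF pre comp lsc K L KL, of e]) (use e in blast)+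
  have clU: "U n \<subseteq> \<tau> closure_of U n" for n
    by (simp add: closure_of_subset op openin_subset)
  have clnest: "\<tau> closure_of U m \<subseteq> U n" if "e m < e n" for m n
    using nest[OF that] subset_thickening[OF d closure_of_subset_topspace] by blast
  \<comment> \<open>Inserting \<open>c\<close> keeps the infimum over a nonempty set, bounds
    \<open>f\<close> by \<open>c\<close>, and gives the value \<open>c\<close> at points lying in no
    \<open>U n\<close>, in particular on \<open>L\<close>.\<close>
  define f where "f x = Inf (insert c (e ` {n. x \<in> U n}))" for x
  have bdd: "bdd_below (insert c (e ` {n. x \<in> U n}))" for x
    by (rule bdd_belowI[of _ 0]) (use e \<open>0 < c\<close> in \<open>auto intro: less_imp_le\<close>)
  have f0: "0 \<le> f x" for x
    unfolding f_def by (rule cInf_greatest) (use e \<open>0 < c\<close> in \<open>auto intro: less_imp_le\<close>)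
  have fc: "f x \<le> c" for x
    unfolding f_def by (rule cInf_lower[OF _ bdd]) simp
  have f_le: "f x \<le> e n" if "x \<in> U n" for x n
    unfolding f_def by (rule cInf_lower[OF _ bdd]) (use that in simp)
  have f_less: "f x < a \<longleftrightarrow> c < a \<or> (\<exists>n. e n < a \<and> x \<in> U n)" for x a
    unfolding f_def by (subst cInf_less_iff[OF _ bdd]) auto
  have f_ge: "e n \<le> f x" if "x \<notin> \<tau> closure_of U n" for x n
  proof (rule ccontr)
    assume "\<not> e n \<le> f x"
    then obtain m where "e m < e n" "x \<in> U m"
      using f_less[of x "e n"] e[of n] by force
    then show False
      using clnest clU that by blast
  qed
  have "continuous_map \<tau> euclideanreal f"
    unfolding continuous_map_upper_lower_semicontinuous_lt
  proof (intro conjI allI)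
    fix a
    have "{x \<in> ?X. f x < a} = (if c < a then ?X else (\<Union>n\<in>{n. e n < a}. U n))"
      using openin_subset[OF op] by (auto simp: f_less)
    then show "openin \<tau> {x \<in> ?X. f x < a}"
      using op by auto
    \<comment> \<open>Two levels are put between \<open>a\<close> and \<open>f x\<close>: the upper
      one excludes \<open>x\<close> from \<open>U m\<close>, and the closure of the lower
      \<open>U n\<close> lies inside \<open>U m\<close>.\<close>
    have "\<exists>n. a < e n \<and> x \<notin> \<tau> closure_of U n" if a: "a < f x" "0 \<le> a" for x
    proof -
      obtain m where m: "a < e m" "e m < f x"
        using dense[OF a fc] by blast
      then obtain n where "a < e n" "e n < e m"
        using dense[of a "e m"] a e[of m] by auto
      then show ?thesis
        using clnest f_le m by (meson leD subsetD)
    qed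
    then have "{x \<in> ?X. a < f x} =
        (if a < 0 then ?X else (\<Union>n\<in>{n. a < e n}. ?X - \<tau> closure_of U n))"
      using f0 f_ge by (force intro: less_le_trans)
    moreover have "openin \<tau> (\<Union>n\<in>{n. a < e n}. ?X - \<tau> closure_of U n)"
      by (intro openin_Union) auto
    ultimately show "openin \<tau> {x \<in> ?X. a < f x}"
      using openin_topspace[of \<tau>] by (simp only: simp_thms split: if_split)
  qed
  moreover have "bounded (f ` ?X)"
    using f0 fc by (intro boundedI[of _ c]) auto
  moreover have "ennreal \<bar>f x - f y\<bar> \<le> d x y" if X: "x \<in> ?X" "y \<in> ?X" for x y
  proof -
    have upper: "ennreal (f y - f x) \<le> d x y" if X: "x \<in> ?X" "y \<in> ?X" for x y
    proof (rule ccontr)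
      assume "\<not> ennreal (f y - f x) \<le> d x y"
      then have *: "d x y < ennreal (f y - f x)"
        by simp
      then obtain \<delta> where \<delta>: "d x y = ennreal \<delta>" "0 \<le> \<delta>"
        by (cases "d x y") auto
      have less: "f x < f y - \<delta>"
        using * \<delta> by (simp add: ennreal_less_iff)
      \<comment> \<open>The levels satisfy \<open>f x < e n\<close> and
        \<open>e n + \<delta> < e m < f y\<close>. Then \<open>x\<close> lies in the closure of
        \<open>U n\<close>, and \<open>y\<close> is within \<open>\<delta>\<close>, hence within
        \<open>e m - e n\<close>, of \<open>x\<close>. So \<open>y\<close> lies in
        \<open>U m\<close>, which forces \<open>f y \<le> e m\<close>.\<close>
      then obtain n where n: "f x < e n" "e n < f y - \<delta>"
        using dense[of "f x" "f y - \<delta>"] f0[of x] fc[of y] \<delta> by auto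
      then obtain m where m: "e n + \<delta> < e m" "e m < f y"
        using dense[of "e n + \<delta>" "f y"] e[of n] fc[of y] \<delta> by auto
      obtain k where "e k < e n" "x \<in> U k"
        using n(1) f_less[of x "e n"] e[of n] by force
      then have "x \<in> \<tau> closure_of U n"
        using clnest clU by blast
      then have "y \<in> thickening \<tau> d (e m - e n) (\<tau> closure_of U n)"
        using X \<delta> m unfolding thickening_def by (auto intro!: bexI[of _ x] ennreal_leI)
      then have "y \<in> U m"
        using nest[of n m] m \<delta> by auto
      then show False
        using f_le m by fastforce
    qed
    show ?thesis
    proof (cases "f x \<le> f y")
      case True
      then show ?thesis
        using upper[OF X] by (simp add: abs_minus_commute)
    next
      case False
      moreover have "d x y = d y x"
        using extended_distance_on_commute[OF d X] .
      ultimately show ?thesis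
        using upper[OF X(2,1)] by simp
    qed
  qed
  ultimately have "f \<in> LIP_b1 \<tau> d"
    by (simp add: LIP_b1_def)
  moreover have "f x = 0" if "x \<in> K" for x
  proof (rule ccontr)
    assume "f x \<noteq> 0"
    then have "0 < f x"
      using f0[of x] by simp
    then obtain n where "e n < f x"
      using dense[of 0 "f x"] fc by auto
    then show False
      using f_le[of x n] KU[of n] that by auto
  qed
  moreover have "f x = c" if "x \<in> L" for x
  proof -
    have "{n. x \<in> U n} = {}"
      using LU that by (auto simp: disjnt_iff)
    then show ?thesis
      unfolding f_def by simp
  qed
  ultimately show thesis
    using that by blast
qed

section \<open>Recovering the distance\<close>

lemma lower_semicontinuous_imp_distance_eq_SUP:
  assumes pre: "pre_emt_space \<tau> d" and comp: "compact_space \<tau>"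
    and lsc: "lower_semicontinuous_map (prod_topology \<tau> \<tau>) (\<lambda>(x, y). d x y)"
    and X: "x \<in> topspace \<tau>" "y \<in> topspace \<tau>"
  shows "d x y = (SUP f\<in>LIP_b1 \<tau> d. ennreal \<bar>f x - f y\<bar>)"
proof (rule antisym)
  show "(SUP f\<in>LIP_b1 \<tau> d. ennreal \<bar>f x - f y\<bar>) \<le> d x y"
    using X by (auto simp: LIP_b1_def intro: SUP_least)
  show "d x y \<le> (SUP f\<in>LIP_b1 \<tau> d. ennreal \<bar>f x - f y\<bar>)"
  \<comment> \<open>Any \<open>z\<close> strictly below \<open>d x y\<close> is finite, so an
    infinite distance needs no separate treatment. Points are closed, and a function separating
    \<open>{x}\<close> from \<open>{y}\<close> by \<open>c\<close> attains the value
    \<open>z\<close>.\<close>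
  proof (rule dense_le)
    fix z assume "z < d x y"
    then obtain c where c: "z = ennreal c" "0 \<le> c"
      by (cases z) auto
    show "z \<le> (SUP f\<in>LIP_b1 \<tau> d. ennreal \<bar>f x - f y\<bar>)"
    proof (cases "c = 0")
      case False
      have "Hausdorff_space \<tau>"
        using lower_semicontinuous_imp_Hausdorff_space[OF pre lsc] .
      then have "closedin \<tau> {x}" "closedin \<tau> {y}"
        using X by (simp_all add: closedin_Hausdorff_singleton)
      moreover have "disjnt (thickening \<tau> d c {x}) {y}"
        using \<open>z < d x y\<close> c by (auto simp: thickening_def disjnt_iff not_le)
      moreover have "0 < c"
        using False c by simp
      ultimately obtain f where f: "f \<in> LIP_b1 \<tau> d" "f x = 0" "f y = c"
        by (auto intro: LIP_b1_separating_closed_sets[OF pre comp lsc, of "{x}" "{y}" c])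
      then have "z = ennreal \<bar>f x - f y\<bar>"
        using c by simp
      then show ?thesis
        using f(1) by (auto intro: SUP_upper)
    qed (use c in simp)
  qed
qed

section \<open>Recovering the topology\<close>

lemma topspace_initial_topology [simp]: "topspace (initial_topology X Y F) = X"
  by (auto simp: initial_topology_def)

lemma openin_initial_topology_preimage:
  "f \<in> F \<Longrightarrow> openin Y U \<Longrightarrow> openin (initial_topology X Y F) {x \<in> X. f x \<in> U}"
  unfolding initial_topology_def by (rule topology_generated_by_Basis) blast

lemma Hausdorff_initial_topology:
  assumes "Hausdorff_space Y" "\<And>f. f \<in> F \<Longrightarrow> f ` X \<subseteq> topspace Y"
    and sep: "\<And>x y. x \<in> X \<Longrightarrow> y \<in> X \<Longrightarrow> x \<noteq> y \<Longrightarrow> \<exists>f\<in>F. f x \<noteq> f y"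
  shows "Hausdorff_space (initial_topology X Y F)"
  unfolding Hausdorff_space_def topspace_initial_topology
proof (intro allI impI)
  fix x y assume xy: "x \<in> X \<and> y \<in> X \<and> x \<noteq> y"
  then obtain f where f: "f \<in> F" "f x \<noteq> f y"
    using sep by blast
  then obtain U V where UV: "openin Y U" "openin Y V" "f x \<in> U" "f y \<in> V" "disjnt U V"
    using assms(1,2) xy unfolding Hausdorff_space_def by (metis image_subset_iff)
  show "\<exists>U V. openin (initial_topology X Y F) U \<and> openin (initial_topology X Y F) V \<and>
      x \<in> U \<and> y \<in> V \<and> disjnt U V"
    using UV xy f(1)
    by (intro exI[of _ "{x \<in> X. f x \<in> U}"] exI[of _ "{x \<in> X. f x \<in> V}"])
       (auto simp: disjnt_iff intro: openin_initial_topology_preimage)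
qed

lemma initial_topology_coarser:
  assumes "\<And>f. f \<in> F \<Longrightarrow> continuous_map \<tau> Y f"
  shows "continuous_map \<tau> (initial_topology (topspace \<tau>) Y F) id"
  unfolding initial_topology_def
proof (rule continuous_on_generated_topo)
  fix U assume "U \<in> insert (topspace \<tau>)
      {{x \<in> topspace \<tau>. f x \<in> U} |f U. f \<in> F \<and> openin Y U}"
  then have "openin \<tau> U"
    using assms by (auto intro: openin_continuous_map_preimage)
  then show "openin \<tau> (id -` U \<inter> topspace \<tau>)"
    by (simp add: openin_Int)
qed auto

text \<open>A \<open>\<tau>\<close>-closed set is \<open>\<tau>\<close>-compact, hence compact in
  the coarser \<open>\<sigma>\<close>, hence \<open>\<sigma>\<close>-closed because
  \<open>\<sigma>\<close> is Hausdorff.\<close>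

lemma compact_eq_coarser_Hausdorff:
  assumes "compact_space \<tau>" "Hausdorff_space \<sigma>" "topspace \<sigma> = topspace \<tau>"
    and id: "continuous_map \<tau> \<sigma> id"
  shows "\<tau> = \<sigma>"
proof -
  have "openin \<tau> S" if "openin \<sigma> S" for S
    using openin_continuous_map_preimage[OF id that] openin_subset[OF that] assms(3)
    by (simp add: Collect_conj_eq Int_absorb1)
  moreover have "openin \<sigma> S" if "openin \<tau> S" for S
  proof -
    have "compactin \<tau> (topspace \<tau> - S)"
      using assms(1) that by (intro closedin_compact_space) auto
    then have "closedin \<sigma> (topspace \<sigma> - S)"
      using image_compactin[OF _ id] compactin_imp_closedin[OF assms(2)] assms(3) by simp
    then show ?thesis
      using openin_subset[OF that] assms(3) by (simp add: openin_closedin_eq)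
  qed
  ultimately show ?thesis
    unfolding topology_eq by blast
qed

theorem proposition2p15:
  fixes \<tau> :: "'a topology" and d :: "'a \<Rightarrow> 'a \<Rightarrow> ennreal"
  assumes "pre_emt_space \<tau> d" and "compact_space \<tau>"
  shows "emt_space \<tau> d \<longleftrightarrow>
    lower_semicontinuous_map (prod_topology \<tau> \<tau>) (\<lambda>(x, y). d x y)"
proof
  show "lower_semicontinuous_map (prod_topology \<tau> \<tau>) (\<lambda>(x, y). d x y)" if "emt_space \<tau> d"
    using that by (rule emt_space_imp_lower_semicontinuous)
next
  assume lsc: "lower_semicontinuous_map (prod_topology \<tau> \<tau>) (\<lambda>(x, y). d x y)"
  let ?\<sigma> = "initial_topology (topspace \<tau>) euclideanreal (LIP_b1 \<tau> d)"
  note SUP = lower_semicontinuous_imp_distance_eq_SUP[OF assms lsc]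
  \<comment> \<open>The supremum formula separates points: if all functions agreed at
    \<open>x\<close> and \<open>y\<close>, their distance would be 0.\<close>
  have "\<exists>f\<in>LIP_b1 \<tau> d. f x \<noteq> f y" if "x \<in> topspace \<tau>" "y \<in> topspace \<tau>" "x \<noteq> y" for x y
  proof (rule ccontr)
    assume "\<not> ?thesis"
    then have "(SUP f\<in>LIP_b1 \<tau> d. ennreal \<bar>f x - f y\<bar>) \<le> 0"
      by (intro SUP_least) simp
    then have "d x y = 0"
      using SUP[OF that(1,2)] by simp
    then show False
      using assms(1) that extended_distance_on_eq_0_iff[of "topspace \<tau>" d x y]
      by (simp add: pre_emt_space_def)
  qed
  then have "Hausdorff_space ?\<sigma>"
    by (intro Hausdorff_initial_topology) (simp_all add: Hausdorff_space_euclidean)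
  moreover have "continuous_map \<tau> ?\<sigma> id"
    by (rule initial_topology_coarser) (simp add: LIP_b1_def)
  ultimately have "\<tau> = ?\<sigma>"
    using assms(2) by (intro compact_eq_coarser_Hausdorff) simp_all
  then show "emt_space \<tau> d"
    using assms(1) SUP unfolding emt_space_def by blast
qed

end
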